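(* Let $f$ be a non-negative integer. If there exists a symmetric $(v,k,\lambda)$-design that is $f$-pyramidal under the action of some group $G$ of automorphisms, then $f\leq v-2(k-\lambda)$ or $f\in\{v-1,v\}$.
   Context: A $(v,k,\lambda)$-design is a pair $\mathcal{D}=(P,\mathcal{B})$ where $P$ is a set of $v$ points and $\mathcal{B}$ is a collection of $k$-subsets of $P$, called blocks, such that every pair of distinct points of $P$ occurs in exactly $\lambda$ blocks. It is symmetric if $|\mathcal{B}|=v$. An automorphism of $\mathcal{D}$ is a permutation of $P$ mapping $\mathcal{B}$ onto itself. Given a group $G$ of automorphisms of $\mathcal{D}$, the design $\mathcal{D}$ is called $f$-pyramidal under the action of $G$ if $G$ fixes exactly $f$ points and acts sharply transitively (regularly) on the remaining $v-f$ points. *)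

theory Defs
  imports "HOL-Algebra.Bij" "HOL-Library.Multiset"
begin

text \<open>
  The blocks form a multiset, so repeated blocks are allowed; a design given by a set \<open>S\<close>
  of blocks is the case \<open>B = mset_set S\<close>.
\<close>

definition block_design :: "nat \<Rightarrow> nat \<Rightarrow> nat \<Rightarrow> 'a set \<Rightarrow> 'a set multiset \<Rightarrow> bool" where
  "block_design v k l P B \<longleftrightarrow>
     finite P \<and> card P = v \<and>
     (\<forall>b\<in>#B. b \<subseteq> P \<and> card b = k) \<and>
     (\<forall>x\<in>P. \<forall>y\<in>P. x \<noteq> y \<longrightarrow> size {#b \<in># B. x \<in> b \<and> y \<in> b#} = l)"

definition symmetric_design :: "nat \<Rightarrow> nat \<Rightarrow> nat \<Rightarrow> 'a set \<Rightarrow> 'a set multiset \<Rightarrow> bool" where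
  "symmetric_design v k l P B \<longleftrightarrow> block_design v k l P B \<and> size B = v"

text \<open>
  Permutations of \<open>P\<close> are represented as in \<^const>\<open>BijGroup\<close>: bijections of \<open>P\<close> that take
  the value \<^const>\<open>undefined\<close> outside \<open>P\<close>.
\<close>

definition design_automorphisms :: "'a set \<Rightarrow> 'a set multiset \<Rightarrow> ('a \<Rightarrow> 'a) set" where
  "design_automorphisms P B = {g \<in> Bij P. image_mset (\<lambda>b. g ` b) B = B}"

definition automorphism_group_of :: "('a \<Rightarrow> 'a) set \<Rightarrow> 'a set \<Rightarrow> 'a set multiset \<Rightarrow> bool" where
  "automorphism_group_of G P B \<longleftrightarrow> subgroup G (BijGroup P) \<and> G \<subseteq> design_automorphisms P B"

definition fixed_points :: "('a \<Rightarrow> 'a) set \<Rightarrow> 'a set \<Rightarrow> 'a set" where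
  "fixed_points G P = {x \<in> P. \<forall>g\<in>G. g x = x}"

definition sharply_transitive_on :: "('a \<Rightarrow> 'a) set \<Rightarrow> 'a set \<Rightarrow> bool" where
  "sharply_transitive_on G S \<longleftrightarrow> (\<forall>x\<in>S. \<forall>y\<in>S. \<exists>!g. g \<in> G \<and> g x = y)"

definition pyramidal_under :: "nat \<Rightarrow> ('a \<Rightarrow> 'a) set \<Rightarrow> 'a set \<Rightarrow> bool" where
  "pyramidal_under f G P \<longleftrightarrow>
     card (fixed_points G P) = f \<and> sharply_transitive_on G (P - fixed_points G P)"

end

theory Submission
  imports Defs
begin

text \<open>
  Let \<open>F\<close> be the set of points fixed by all of \<open>G\<close>. If two distinct points lie outside \<open>F\<close>, some
  \<open>g \<in> G\<close> maps one to the other, and by sharp transitivity this \<open>g\<close> fixes no point outside \<open>F\<close>.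
  Hence \<open>f\<close> is the number of fixed points of a single automorphism \<open>g\<close> that moves a point, and it
  suffices that such an automorphism fixes at most \<open>v - 2(k - l)\<close> points (lemma
  \<open>card_fixed_points_of_automorphism\<close>). If at most one point lies outside \<open>F\<close>, then \<open>f\<close> is
  \<open>v - 1\<close> or \<open>v\<close>.

  For the bound on a single automorphism, the main case is \<open>k \<ge> 2\<close> and \<open>k > l\<close>. If \<open>g\<close> moves \<open>x\<close>,
  then the \<open>k - l\<close> blocks through \<open>x\<close> that miss \<open>g x\<close> and the \<open>k - l\<close> blocks through \<open>g x\<close> that
  miss \<open>x\<close> are all moved by \<open>g\<close>. So at least \<open>2(k - l)\<close> blocks are moved, and it
  remains to see that \<open>g\<close> moves as many points as blocks
  (lemma \<open>automorphism_moves_as_many_points_as_blocks\<close>).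
  This is usually derived from the invertibility of the incidence matrix. Here it is obtained by
  double counting the sum of \<open>card (g ` b \<inter> b)\<close> over all blocks \<open>b\<close>: a fixed block contributes \<open>k\<close>
  and a moved one \<open>l\<close>, because two blocks of a symmetric design meet in \<open>l\<close> points
  (lemma \<open>blocks_intersect_in_index\<close>); and from the side of the points, a fixed point contributes
  \<open>k\<close> and a moved one \<open>l\<close>.

  Blocks may be repeated here, and for \<open>k = 1\<close> they can be. The counting for \<open>k \<ge> 2\<close> works with
  multiplicities throughout. For \<open>k \<le> 1\<close> the bound follows from the fact that a permutation
  which moves one point moves at least two, and for \<open>k \<le> l\<close> it is trivial.
\<close>

section \<open>Incidence counts in symmetric designs\<close>

lemma double_count:
  assumes "finite A"
  shows "(\<Sum>x\<in>A. size {#b \<in># B. Q x b#}) = (\<Sum>b\<in>#B. card {x \<in> A. Q x b})"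
proof (induction B)
  case empty
  then show ?case by simp
next
  case (add c B)
  have "(\<Sum>x\<in>A. size {#b \<in># add_mset c B. Q x b#})
      = (\<Sum>x\<in>A. (if Q x c then 1 else 0) + size {#b \<in># B. Q x b#})"
    by (intro sum.cong) auto
  also have "\<dots> = card {x \<in> A. Q x c} + (\<Sum>x\<in>A. size {#b \<in># B. Q x b#})"
    using assms by (simp add: sum.distrib sum.If_cases Int_def)
  finally show ?case using add.IH by simp
qed

lemma sum_mset_two_values:
  "(\<Sum>b\<in>#B. if Q b then m else n) = size {#b \<in># B. Q b#} * m + size {#b \<in># B. \<not> Q b#} * (n::nat)"
  by (induction B) auto

lemma size_filter_split:
  "size {#b \<in># B. Q b#} = size {#b \<in># B. Q b \<and> R b#} + size {#b \<in># B. Q b \<and> \<not> R b#}"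
  by (induction B) auto

context
  fixes v k l :: nat and P :: "'a set" and B :: "'a set multiset"
  assumes sym: "symmetric_design v k l P B"
begin

lemma finite_points: "finite P" and card_points: "card P = v" and size_blocks: "size B = v"
  using sym by (auto simp: symmetric_design_def block_design_def)

lemma block_subset: "b \<in># B \<Longrightarrow> b \<subseteq> P" and card_block: "b \<in># B \<Longrightarrow> card b = k"
  using sym by (auto simp: symmetric_design_def block_design_def)

lemma finite_block: "b \<in># B \<Longrightarrow> finite b"
  using block_subset finite_points finite_subset by blast

lemma blocks_through_pair:
  "x \<in> P \<Longrightarrow> y \<in> P \<Longrightarrow> x \<noteq> y \<Longrightarrow> size {#b \<in># B. x \<in> b \<and> y \<in> b#} = l"
  using sym by (auto simp: symmetric_design_def block_design_def)

text \<open>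
  Both sides count the pairs of a block through \<open>x\<close> and a further point on that block.
\<close>

lemma replication_equation:
  assumes x: "x \<in> P"
  shows "size {#b \<in># B. x \<in> b#} * (k - 1) = l * (v - 1)"
proof -
  have "l * (v - 1) = (\<Sum>y\<in>P - {x}. l)"
    using x finite_points card_points by simp
  also have "\<dots> = (\<Sum>y\<in>P - {x}. size {#b \<in># B. x \<in> b \<and> y \<in> b#})"
    using x blocks_through_pair by (intro sum.cong) auto
  also have "\<dots> = (\<Sum>b\<in>#B. card {y \<in> P - {x}. x \<in> b \<and> y \<in> b})"
    using finite_points by (intro double_count) auto
  also have "\<dots> = (\<Sum>b\<in>#B. if x \<in> b then k - 1 else 0)"
  proof (intro arg_cong[of _ _ sum_mset] image_mset_cong)
    fix b assume b: "b \<in># B"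
    have "{y \<in> P - {x}. x \<in> b \<and> y \<in> b} = (if x \<in> b then b - {x} else {})"
      using block_subset[OF b] by auto
    then show "card {y \<in> P - {x}. x \<in> b \<and> y \<in> b} = (if x \<in> b then k - 1 else 0)"
      using card_block[OF b] finite_block[OF b] by simp
  qed
  also have "\<dots> = size {#b \<in># B. x \<in> b#} * (k - 1)"
    by (simp add: sum_mset_two_values)
  finally show ?thesis by simp
qed

text \<open>
  For \<open>k \<ge> 2\<close> the preceding equation makes the number of blocks through a point constant, and
  counting all incidences shows that the constant is \<open>k\<close>, as there are as many blocks as points.
\<close>

lemma blocks_through_point:
  assumes k: "k \<ge> 2" and x: "x \<in> P"
  shows "size {#b \<in># B. x \<in> b#} = k"
proof -
  let ?r = "\<lambda>x. size {#b \<in># B. x \<in> b#}"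
  have const: "?r y = ?r x" if "y \<in> P" for y
    using replication_equation[OF x] replication_equation[OF that] k
    by (metis Suc_1 Suc_le_lessD mult_right_cancel not_less_eq_eq zero_less_diff less_numeral_extra(3))
  have "v * ?r x = (\<Sum>y\<in>P. ?r y)"
    using const card_points by simp
  also have "\<dots> = (\<Sum>b\<in>#B. card {y \<in> P. y \<in> b})"
    using finite_points by (rule double_count)
  also have "\<dots> = (\<Sum>b\<in>#B. k)"
  proof (intro arg_cong[of _ _ sum_mset] image_mset_cong)
    fix b assume b: "b \<in># B"
    then have "{y \<in> P. y \<in> b} = b" using block_subset by auto
    then show "card {y \<in> P. y \<in> b} = k" using card_block[OF b] by simp
  qed
  also have "\<dots> = v * k" using size_blocks by simp
  finally show ?thesis using x card_points finite_points by auto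
qed

lemma blocks_separating:
  assumes k: "k \<ge> 2" and xy: "x \<in> P" "y \<in> P" "x \<noteq> y"
  shows "size {#b \<in># B. x \<in> b \<and> y \<notin> b#} = k - l"
  using size_filter_split[of "\<lambda>b. x \<in> b" B "\<lambda>b. y \<in> b"] blocks_through_point[OF k xy(1)]
    blocks_through_pair[OF xy] by linarith

text \<open>
  A second-moment argument: the intersection numbers of a given block \<open>a\<close> with the other blocks
  have mean \<open>l\<close> and mean square \<open>l\<^sup>2\<close>, so that each of them equals \<open>l\<close>. Removing one copy of \<open>a\<close>
  from \<open>B\<close> covers repeated blocks as well.
\<close>

lemma blocks_intersect_in_index:
  assumes k: "k \<ge> 2" and a: "a \<in># B" and b: "b \<in># B - {#a#}"
  shows "card (b \<inter> a) = l"
proof -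
  define B' where "B' = B - {#a#}"
  have B: "B = add_mset a B'" using a by (simp add: B'_def)
  note fin = finite_block[OF a] and ca = card_block[OF a] and aP = block_subset[OF a]
  have v: "v \<ge> 1" using a size_blocks by (cases v) auto
  have pt: "size {#b \<in># B'. x \<in> b#} = k - 1" if "x \<in> a" for x
    using blocks_through_point[OF k, of x] that aP by (auto simp: B)
  have pair: "size {#b \<in># B'. x \<in> b \<and> y \<in> b#} = l - 1" "l \<ge> 1"
    if "x \<in> a" "y \<in> a" "x \<noteq> y" for x y
    using blocks_through_pair[OF subsetD[OF aP that(1)] subsetD[OF aP that(2)] that(3)] that
    by (auto simp: B)
  have l: "l \<ge> 1"
  proof -
    from k ca obtain x y where "x \<in> a" "y \<in> a" "x \<noteq> y"
      by (metis card_le_Suc0_iff_eq fin not_less_eq_eq numeral_2_eq_2)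
    then show ?thesis by (rule pair(2))
  qed
  have "k * (k - 1) = l * (v - 1)"
  proof -
    from k ca obtain x where x: "x \<in> a" by fastforce
    then have xP: "x \<in> P" using aP by auto
    show ?thesis
      using replication_equation[OF xP] blocks_through_point[OF k xP] by simp
  qed
  then have kl: "int k * (int k - 1) = int l * (int v - 1)"
    using k v by (metis One_nat_def Suc_1 Suc_leD of_nat_1 of_nat_diff of_nat_mult)
  have int_sum: "int (\<Sum>c\<in>#M. h c) = (\<Sum>c\<in>#M. int (h c))" for M :: "'a set multiset" and h
    by (induction M) auto
  have "(\<Sum>c\<in>#B'. card (c \<inter> a)) = (\<Sum>c\<in>#B'. card {x \<in> a. x \<in> c})"
    by (simp add: Int_def conj_commute)
  also have "\<dots> = (\<Sum>x\<in>a. size {#b \<in># B'. x \<in> b#})"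
    by (rule double_count[symmetric, OF fin])
  also have "\<dots> = k * (k - 1)" using pt ca by simp
  finally have S1: "(\<Sum>c\<in>#B'. int (card (c \<inter> a))) = int k * (int k - 1)"
    using k by (simp flip: int_sum add: of_nat_diff)
  have "(\<Sum>c\<in>#B'. card (c \<inter> a) * card (c \<inter> a))
      = (\<Sum>c\<in>#B'. card {p \<in> a \<times> a. fst p \<in> c \<and> snd p \<in> c})"
  proof (intro arg_cong[of _ _ sum_mset] image_mset_cong)
    fix c
    have "{p \<in> a \<times> a. fst p \<in> c \<and> snd p \<in> c} = (c \<inter> a) \<times> (c \<inter> a)" by auto
    then show "card (c \<inter> a) * card (c \<inter> a) = card {p \<in> a \<times> a. fst p \<in> c \<and> snd p \<in> c}"
      by (simp add: card_cartesian_product)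
  qed
  also have "\<dots> = (\<Sum>p\<in>a \<times> a. size {#b \<in># B'. fst p \<in> b \<and> snd p \<in> b#})"
    using fin by (intro double_count[symmetric]) auto
  also have "\<dots> = (\<Sum>x\<in>a. \<Sum>y\<in>a. size {#b \<in># B'. x \<in> b \<and> y \<in> b#})"
    by (simp add: sum.cartesian_product case_prod_unfold)
  also have "\<dots> = (\<Sum>x\<in>a. (k - 1) + (k - 1) * (l - 1))"
  proof (intro sum.cong refl)
    fix x assume x: "x \<in> a"
    have "(\<Sum>y\<in>a. size {#b \<in># B'. x \<in> b \<and> y \<in> b#})
        = size {#b \<in># B'. x \<in> b#} + (\<Sum>y\<in>a - {x}. size {#b \<in># B'. x \<in> b \<and> y \<in> b#})"
      using x fin by (simp add: sum.remove)
    also have "(\<Sum>y\<in>a - {x}. size {#b \<in># B'. x \<in> b \<and> y \<in> b#}) = (\<Sum>y\<in>a - {x}. l - 1)"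
      using x pair(1) by (intro sum.cong) auto
    finally show "(\<Sum>y\<in>a. size {#b \<in># B'. x \<in> b \<and> y \<in> b#}) = (k - 1) + (k - 1) * (l - 1)"
      using pt[OF x] ca x fin by simp
  qed
  also have "\<dots> = k * (k - 1) * l"
    using ca l by (cases l) (auto simp: algebra_simps)
  finally have S2: "(\<Sum>c\<in>#B'. int (card (c \<inter> a)) * int (card (c \<inter> a)))
      = int k * (int k - 1) * int l"
    using k by (simp flip: int_sum of_nat_mult) (simp add: of_nat_diff)
  have expand: "(\<Sum>c\<in>#M. (int (h c) - int l)\<^sup>2)
      = (\<Sum>c\<in>#M. int (h c) * int (h c)) - 2 * int l * (\<Sum>c\<in>#M. int (h c)) + int (size M) * (int l)\<^sup>2"
    for M :: "'a set multiset" and h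
    by (induction M) (auto simp: algebra_simps power2_eq_square)
  have "int (size B') = int v - 1" using size_blocks by (simp add: B)
  then have "(\<Sum>c\<in>#B'. (int (card (c \<inter> a)) - int l)\<^sup>2)
      = int k * (int k - 1) * int l - 2 * int l * (int k * (int k - 1)) + (int v - 1) * (int l)\<^sup>2"
    by (simp add: expand S1 S2)
  also have "\<dots> = 0" unfolding kl by (simp add: power2_eq_square algebra_simps)
  finally have zero: "(\<Sum>c\<in>#B'. (int (card (c \<inter> a)) - int l)\<^sup>2) = 0" .
  have nonneg: "0 \<le> (\<Sum>c\<in>#M. (int (card (c \<inter> a)) - int l)\<^sup>2)" for M :: "'a set multiset"
    by (induction M) auto
  obtain M where "B' = add_mset b M" using b by (metis B'_def multi_member_split)
  then have "(int (card (b \<inter> a)) - int l)\<^sup>2 + (\<Sum>c\<in>#M. (int (card (c \<inter> a)) - int l)\<^sup>2) = 0"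
    using zero by simp
  then have "(int (card (b \<inter> a)) - int l)\<^sup>2 = 0"
    using nonneg[of M] zero_le_power2[of "int (card (b \<inter> a)) - int l"] by linarith
  then show ?thesis by simp
qed

section \<open>Points and blocks moved by an automorphism\<close>

context
  fixes g assumes aut: "g \<in> design_automorphisms P B"
begin

lemma automorphism_inj: "inj_on g P"
  using aut by (auto simp: design_automorphisms_def Bij_def bij_betw_def)

lemma automorphism_in: "x \<in> P \<Longrightarrow> g x \<in> P"
  using aut by (auto simp: design_automorphisms_def Bij_def bij_betw_def)

lemma automorphism_block: "b \<in># B \<Longrightarrow> g ` b \<in># B"
  using aut by (simp add: design_automorphisms_def) (metis imageI set_image_mset)

text \<open>
  Both sides of the identity below equal the number of pairs of a block \<open>b\<close> and a point \<open>x\<close> with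
  \<open>x \<in> b\<close> and \<open>g x \<in> b\<close>; for a given \<open>b\<close> these \<open>x\<close> correspond under \<open>g\<close> to the points of
  \<open>g ` b \<inter> b\<close>.
\<close>

lemma automorphism_moves_as_many_points_as_blocks:
  assumes k: "k \<ge> 2" and kl: "l < k"
  shows "card {x \<in> P. g x \<noteq> x} = size {#b \<in># B. g ` b \<noteq> b#}"
proof -
  have pts: "card {x \<in> P. g x = x} + card {x \<in> P. g x \<noteq> x} = v"
    using finite_points card_points by (subst card_Un_disjoint[symmetric]) (auto intro: arg_cong[of _ _ card])
  have bls: "size {#b \<in># B. g ` b = b#} + size {#b \<in># B. g ` b \<noteq> b#} = v"
    using size_filter_split[of "\<lambda>_. True" B "\<lambda>b. g ` b = b"] size_blocks by simp
  have "(\<Sum>x\<in>P. size {#b \<in># B. x \<in> b \<and> g x \<in> b#}) = (\<Sum>x\<in>P. if g x = x then k else l)"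
    using blocks_through_point[OF k] blocks_through_pair automorphism_in
    by (intro sum.cong) auto
  also have "\<dots> = card {x \<in> P. g x = x} * k + card {x \<in> P. g x \<noteq> x} * l"
    using finite_points by (simp add: sum.If_cases Int_def)
  finally have points: "(\<Sum>x\<in>P. size {#b \<in># B. x \<in> b \<and> g x \<in> b#})
      = card {x \<in> P. g x = x} * k + card {x \<in> P. g x \<noteq> x} * l" .
  have "(\<Sum>b\<in>#B. card {x \<in> P. x \<in> b \<and> g x \<in> b}) = (\<Sum>b\<in>#B. if g ` b = b then k else l)"
  proof (intro arg_cong[of _ _ sum_mset] image_mset_cong)
    fix b assume b: "b \<in># B"
    have "inj_on g {x \<in> P. x \<in> b \<and> g x \<in> b}"
      using automorphism_inj by (rule inj_on_subset) auto
    moreover have "g ` {x \<in> P. x \<in> b \<and> g x \<in> b} = g ` b \<inter> b"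
      using block_subset[OF b] by auto
    ultimately have c: "card {x \<in> P. x \<in> b \<and> g x \<in> b} = card (g ` b \<inter> b)"
      by (metis card_image)
    show "card {x \<in> P. x \<in> b \<and> g x \<in> b} = (if g ` b = b then k else l)"
    proof (cases "g ` b = b")
      case True
      then show ?thesis using c card_block[OF b] by simp
    next
      case False
      then have "g ` b \<in># B - {#b#}"
        using automorphism_block[OF b] b by (metis insert_DiffM insertE set_mset_add_mset_insert)
      then show ?thesis using c False blocks_intersect_in_index[OF k b] by simp
    qed
  qed
  then have "card {x \<in> P. g x = x} * k + card {x \<in> P. g x \<noteq> x} * l
      = size {#b \<in># B. g ` b = b#} * k + size {#b \<in># B. g ` b \<noteq> b#} * l"
    using double_count[OF finite_points, of "\<lambda>x b. x \<in> b \<and> g x \<in> b" B] points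
    by (simp add: sum_mset_two_values)
  moreover have "int p * int k + int q * int l = int v * int k - int q * (int k - int l)"
    if "p + q = v" for p q
    using that by (auto simp: algebra_simps)
  ultimately have "int (card {x \<in> P. g x \<noteq> x}) * (int k - int l)
      = int (size {#b \<in># B. g ` b \<noteq> b#}) * (int k - int l)"
    using pts bls by (smt (verit) of_nat_add of_nat_mult)
  then show ?thesis using kl by simp
qed

text \<open>
  A block that contains exactly one of \<open>x\<close> and \<open>g x\<close> is moved, since a block fixed by \<open>g\<close>
  contains both or neither. The two kinds of such blocks are disjoint and have \<open>k - l\<close> members each.
\<close>

lemma moved_blocks_bound:
  assumes k: "k \<ge> 2" and x: "x \<in> P" "g x \<noteq> x"
  shows "2 * (k - l) \<le> size {#b \<in># B. g ` b \<noteq> b#}"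
proof -
  note gx = automorphism_in[OF x(1)]
  have "2 * (k - l) = size ({#b \<in># B. x \<in> b \<and> g x \<notin> b#} + {#b \<in># B. g x \<in> b \<and> x \<notin> b#})"
    using blocks_separating[OF k x(1) gx] blocks_separating[OF k gx x(1)] x(2) by simp
  also have "{#b \<in># B. x \<in> b \<and> g x \<notin> b#} + {#b \<in># B. g x \<in> b \<and> x \<notin> b#}
      = {#b \<in># B. x \<in> b \<and> g x \<notin> b \<or> g x \<in> b \<and> x \<notin> b#}"
    by (rule multiset_eqI) auto
  also have "\<dots> = {#b \<in># {#b \<in># B. g ` b \<noteq> b#}. x \<in> b \<and> g x \<notin> b \<or> g x \<in> b \<and> x \<notin> b#}"
  proof -
    have "g ` b \<noteq> b" if b: "b \<in># B" "x \<in> b \<and> g x \<notin> b \<or> g x \<in> b \<and> x \<notin> b" for b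
    proof -
      have "g x \<in> g ` b \<longleftrightarrow> x \<in> b"
        using automorphism_inj block_subset[OF b(1)] x(1) by (meson inj_on_image_mem_iff)
      then show ?thesis using b(2) by auto
    qed
    then show ?thesis by (auto simp: filter_filter_mset intro!: filter_mset_cong)
  qed
  also have "size \<dots> \<le> size {#b \<in># B. g ` b \<noteq> b#}"
    by (rule size_filter_mset_lesseq)
  finally show ?thesis .
qed

text \<open>
  For \<open>k \<ge> 2\<close> and \<open>k > l\<close> the preceding two lemmas combine to the claim. In all other cases
  \<open>k - l \<le> 1\<close>, and it is enough that both \<open>x\<close> and \<open>g x\<close> are moved.
\<close>

lemma card_fixed_points_of_automorphism:
  assumes x: "x \<in> P" "g x \<noteq> x"
  shows "int (card {z \<in> P. g z = z}) \<le> int v - 2 * (int k - int l)"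
proof -
  have v: "v = card {z \<in> P. g z = z} + card {z \<in> P. g z \<noteq> z}"
    using finite_points card_points by (subst card_Un_disjoint[symmetric]) (auto intro: arg_cong[of _ _ card])
  have "2 * (int k - int l) \<le> int (card {z \<in> P. g z \<noteq> z})"
  proof (cases "k \<ge> 2 \<and> l < k")
    case True
    then show ?thesis
      using automorphism_moves_as_many_points_as_blocks moved_blocks_bound[OF _ x] by auto
  next
    case False
    have "g (g x) \<noteq> g x"
      using automorphism_inj automorphism_in[OF x(1)] x by (meson inj_onD)
    then have "{x, g x} \<subseteq> {z \<in> P. g z \<noteq> z}"
      using x automorphism_in by auto
    then have "card {x, g x} \<le> card {z \<in> P. g z \<noteq> z}"
      using finite_points by (intro card_mono) auto
    then have "2 \<le> card {z \<in> P. g z \<noteq> z}" using x(2) by auto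
    then show ?thesis using False by auto
  qed
  then show ?thesis using v by linarith
qed

end

end

section \<open>Pyramidal designs\<close>

text \<open>
  A group element fixing a point of a set on which \<open>G\<close> is sharply transitive agrees there with the
  identity of \<open>G\<close>, hence equals it.
\<close>

lemma sharply_transitive_fixed_points:
  assumes G: "subgroup G (BijGroup P)"
    and st: "sharply_transitive_on G (P - fixed_points G P)"
    and g: "g \<in> G" and x: "x \<in> P" "g x \<noteq> x"
  shows "{z \<in> P. g z = z} = fixed_points G P"
proof (rule ccontr)
  assume "\<not> ?thesis"
  then obtain z where z: "z \<in> P - fixed_points G P" "g z = z"
    using g by (auto simp: fixed_points_def)
  have one: "(\<lambda>x\<in>P. x) \<in> G"
    using subgroup.one_closed[OF G] by (simp add: BijGroup_def)
  have "\<exists>!h. h \<in> G \<and> h z = z"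
    using st z(1) by (auto simp: sharply_transitive_on_def)
  moreover have "(\<lambda>x\<in>P. x) z = z" using z(1) by simp
  ultimately have "g = (\<lambda>x\<in>P. x)" using one g z(2) by blast
  then show False using x by simp
qed

theorem theorem2p3:
  fixes f v k l :: nat
  assumes "\<exists>(P :: 'a set) B G. symmetric_design v k l P B \<and>
             automorphism_group_of G P B \<and> pyramidal_under f G P"
  shows "int f \<le> int v - 2 * (int k - int l) \<or> int f \<in> {int v - 1, int v}"
proof -
  obtain P :: "'a set" and B G where sym: "symmetric_design v k l P B"
    and G: "subgroup G (BijGroup P)" "G \<subseteq> design_automorphisms P B"
    and f: "card (fixed_points G P) = f"
    and st: "sharply_transitive_on G (P - fixed_points G P)"
    using assms by (auto simp: automorphism_group_of_def pyramidal_under_def)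
  note fin = finite_points[OF sym]
  have sub: "fixed_points G P \<subseteq> P" by (auto simp: fixed_points_def)
  have moved: "card (P - fixed_points G P) = v - f" and fv: "f \<le> v"
    using f card_points[OF sym] sub fin card_mono[OF fin sub]
    by (auto simp: card_Diff_subset finite_subset)
  show ?thesis
  proof (cases "card (P - fixed_points G P) \<le> 1")
    case True
    then show ?thesis using moved fv by auto
  next
    case False
    then obtain x y where xy: "x \<in> P - fixed_points G P" "y \<in> P - fixed_points G P" "x \<noteq> y"
      using fin by (metis One_nat_def card_le_Suc0_iff_eq finite_Diff)
    then obtain g where g: "g \<in> G" "g x = y"
      using st unfolding sharply_transitive_on_def by blast
    have x: "x \<in> P" "g x \<noteq> x" using xy g by auto
    have "int (card {z \<in> P. g z = z}) \<le> int v - 2 * (int k - int l)"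
      using g(1) G(2) by (intro card_fixed_points_of_automorphism[where x = x, OF sym] x) auto
    then show ?thesis
      using sharply_transitive_fixed_points[OF G(1) st g(1) x] f by simp
  qed
qed

end
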